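(* Let $G$ and $H$ be two groups with $G$ non-trivial, and let $X$ be a set on which $H$ acts. Then the wreath product $G\wr_X H$ has uncountable cofinality if and only if $G$ and $H$ have uncountable cofinality and $H$ acts on $X$ with finitely many orbits.
   Context: Wreath product: $\bigoplus_X G$ is the group (with componentwise multiplication) of functions $\varphi\colon X\to G$ with $\varphi(x)=1$ for all but finitely many $x$. The group $H$ acts on it by $(h.\varphi)(x)=\varphi(h^{-1}.x)$, and $G\wr_X H:=(\bigoplus_X G)\rtimes H$. A metric space $(Y,d)$ is ultrametric if $d(x,y)\le\max\{d(x,z),d(z,y)\}$ for all $x,y,z$. A group has uncountable cofinality if every action by (bijective) isometries on an ultrametric space has bounded orbits.
   Formalization: The set X is assumed non-empty; for empty X the wreath product is just H, and the claim fails, e.g. for H trivial and G an infinite direct sum of copies of Z/2, which does not have uncountable cofinality. *)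

theory Defs
  imports
    "HOL-Algebra.Group_Action"
    "HOL-Algebra.Product_Groups"
    "HOL-Analysis.Abstract_Metric_Spaces"
begin

section \<open>Semidirect products and permutational wreath products\<close>

definition semidirect_product ::
    "('n, 'p) monoid_scheme \<Rightarrow> ('h, 'q) monoid_scheme \<Rightarrow> ('h \<Rightarrow> 'n \<Rightarrow> 'n) \<Rightarrow> ('n \<times> 'h) monoid"
  where "semidirect_product N H \<theta> =
    \<lparr>carrier = carrier N \<times> carrier H,
     mult = \<lambda>(n, h) (n', h'). (n \<otimes>\<^bsub>N\<^esub> \<theta> h n', h \<otimes>\<^bsub>H\<^esub> h'),
     one = (\<one>\<^bsub>N\<^esub>, \<one>\<^bsub>H\<^esub>)\<rparr>"

definition wreath_action ::
    "('g, 'p) monoid_scheme \<Rightarrow> 'x set \<Rightarrow> ('h, 'q) monoid_scheme \<Rightarrow> ('h \<Rightarrow> 'x \<Rightarrow> 'x) \<Rightarrow>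
     'h \<Rightarrow> ('x \<Rightarrow> 'g) \<Rightarrow> ('x \<Rightarrow> 'g)"
  where "wreath_action G X H \<alpha> h =
    (\<lambda>f \<in> carrier (sum_group X (\<lambda>_. G)). \<lambda>x \<in> X. f (\<alpha> (inv\<^bsub>H\<^esub> h) x))"

definition wreath_product ::
    "('g, 'p) monoid_scheme \<Rightarrow> 'x set \<Rightarrow> ('h, 'q) monoid_scheme \<Rightarrow> ('h \<Rightarrow> 'x \<Rightarrow> 'x) \<Rightarrow>
     (('x \<Rightarrow> 'g) \<times> 'h) monoid"
  where "wreath_product G X H \<alpha> =
    semidirect_product (sum_group X (\<lambda>_. G)) H (wreath_action G X H \<alpha>)"

lemma group_semidirect_product:
  assumes N: "group N" and H: "group H" and \<theta>: "\<theta> \<in> hom H (AutoGroup N)"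
  shows "group (semidirect_product N H \<theta>)"
proof -
  interpret N: group N by fact
  interpret H: group H by fact
  have car: "\<theta> h \<in> auto N" if "h \<in> carrier H" for h
    using \<theta> that by (auto simp: hom_def AutoGroup_def)
  have cl: "\<theta> h n \<in> carrier N" if "h \<in> carrier H" "n \<in> carrier N" for h n
    using car[OF that(1)] that(2) by (auto simp: auto_def hom_def)
  have ml: "\<theta> h (m \<otimes>\<^bsub>N\<^esub> n) = \<theta> h m \<otimes>\<^bsub>N\<^esub> \<theta> h n"
    if "h \<in> carrier H" "m \<in> carrier N" "n \<in> carrier N" for h m n
    using car[OF that(1)] that(2,3) by (auto simp: auto_def hom_def)
  have comp: "\<theta> (h \<otimes>\<^bsub>H\<^esub> k) n = \<theta> h (\<theta> k n)"
    if "h \<in> carrier H" "k \<in> carrier H" "n \<in> carrier N" for h k n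
  proof -
    have "\<theta> (h \<otimes>\<^bsub>H\<^esub> k) = compose (carrier N) (\<theta> h) (\<theta> k)"
      using \<theta> that car[OF that(1)] car[OF that(2)]
      by (auto simp: hom_def AutoGroup_def BijGroup_def auto_def)
    then show ?thesis using that by (simp add: compose_def)
  qed
  have inj: "inj_on (\<theta> h) (carrier N)" if "h \<in> carrier H" for h
    using car[OF that] by (auto simp: auto_def Bij_def bij_betw_def)
  have id: "\<theta> \<one>\<^bsub>H\<^esub> n = n" if "n \<in> carrier N" for n
    using comp[of "\<one>\<^bsub>H\<^esub>" "\<one>\<^bsub>H\<^esub>" n] inj_onD[OF inj, of "\<one>\<^bsub>H\<^esub>" "\<theta> \<one>\<^bsub>H\<^esub> n" n]
      cl[of "\<one>\<^bsub>H\<^esub>" n] that by simp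
  show ?thesis
  proof (rule groupI)
    fix x assume x: "x \<in> carrier (semidirect_product N H \<theta>)"
    obtain n h where nh: "x = (n, h)" "n \<in> carrier N" "h \<in> carrier H"
      using x by (auto simp: semidirect_product_def)
    let ?y = "(\<theta> (inv\<^bsub>H\<^esub> h) (inv\<^bsub>N\<^esub> n), inv\<^bsub>H\<^esub> h)"
    have "\<theta> (inv\<^bsub>H\<^esub> h) (inv\<^bsub>N\<^esub> n) \<otimes>\<^bsub>N\<^esub> \<theta> (inv\<^bsub>H\<^esub> h) n = \<theta> (inv\<^bsub>H\<^esub> h) \<one>\<^bsub>N\<^esub>"
      using nh by (metis H.inv_closed N.inv_closed N.l_inv ml)
    moreover have "\<theta> k \<one>\<^bsub>N\<^esub> = \<one>\<^bsub>N\<^esub>" if "k \<in> carrier H" for k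
      using ml[OF that, of "\<one>\<^bsub>N\<^esub>" "\<one>\<^bsub>N\<^esub>"] cl[OF that, of "\<one>\<^bsub>N\<^esub>"] by auto
    ultimately have "?y \<otimes>\<^bsub>semidirect_product N H \<theta>\<^esub> x = \<one>\<^bsub>semidirect_product N H \<theta>\<^esub>"
      using nh by (simp add: semidirect_product_def)
    moreover have "?y \<in> carrier (semidirect_product N H \<theta>)"
      using nh cl by (simp add: semidirect_product_def)
    ultimately show "\<exists>y\<in>carrier (semidirect_product N H \<theta>).
        y \<otimes>\<^bsub>semidirect_product N H \<theta>\<^esub> x = \<one>\<^bsub>semidirect_product N H \<theta>\<^esub>" by blast
  qed (auto simp: semidirect_product_def cl ml comp id N.m_assoc H.m_assoc)
qed

lemma wreath_action_hom:
  assumes G: "group G" and act: "group_action H X \<alpha>"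
  shows "wreath_action G X H \<alpha> \<in> hom H (AutoGroup (sum_group X (\<lambda>_. G)))"
proof -
  interpret G: group G by fact
  interpret A: group_action H X \<alpha> by fact
  interpret H: group H using A.group_hom by (simp add: group_hom_def)
  let ?N = "sum_group X (\<lambda>_. G)" and ?w = "wreath_action G X H \<alpha>"
  have carN: "carrier ?N = {f \<in> X \<rightarrow>\<^sub>E carrier G. finite {x \<in> X. f x \<noteq> \<one>\<^bsub>G\<^esub>}}"
    using carrier_sum_group[of X "\<lambda>_. G"] G by simp
  have aX: "\<alpha> h x \<in> X" if "h \<in> carrier H" "x \<in> X" for h x
    using A.element_image that by blast
  have cl: "?w h f \<in> carrier ?N" if h: "h \<in> carrier H" and f: "f \<in> carrier ?N" for h f
  proof -
    have "{x \<in> X. f (\<alpha> (inv\<^bsub>H\<^esub> h) x) \<noteq> \<one>\<^bsub>G\<^esub>} \<subseteq> \<alpha> h ` {x \<in> X. f x \<noteq> \<one>\<^bsub>G\<^esub>}"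
    proof
      fix x assume x: "x \<in> {x \<in> X. f (\<alpha> (inv\<^bsub>H\<^esub> h) x) \<noteq> \<one>\<^bsub>G\<^esub>}"
      then have "x = \<alpha> h (\<alpha> (inv\<^bsub>H\<^esub> h) x)"
        using A.orbit_sym_aux[of "inv\<^bsub>H\<^esub> h" x] h by simp
      then show "x \<in> \<alpha> h ` {x \<in> X. f x \<noteq> \<one>\<^bsub>G\<^esub>}" using x h aX by auto
    qed
    then have "finite {x \<in> X. f (\<alpha> (inv\<^bsub>H\<^esub> h) x) \<noteq> \<one>\<^bsub>G\<^esub>}"
      using f by (auto simp: carN intro: finite_subset)
    moreover have "{x \<in> X. (x \<in> X \<longrightarrow> f (\<alpha> (inv\<^bsub>H\<^esub> h) x) \<noteq> \<one>\<^bsub>G\<^esub>)} = {x \<in> X. f (\<alpha> (inv\<^bsub>H\<^esub> h) x) \<noteq> \<one>\<^bsub>G\<^esub>}"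
      by auto
    ultimately show ?thesis
      using f h aX[of "inv\<^bsub>H\<^esub> h"]
      by (auto simp: wreath_action_def carN PiE_iff cong: conj_cong)
  qed
  have comp: "?w (h \<otimes>\<^bsub>H\<^esub> k) f = ?w h (?w k f)"
    if h: "h \<in> carrier H" and k: "k \<in> carrier H" and f: "f \<in> carrier ?N" for h k f
  proof
    fix x
    show "?w (h \<otimes>\<^bsub>H\<^esub> k) f x = ?w h (?w k f) x"
      using cl[OF k f] f h k aX[of "inv\<^bsub>H\<^esub> h" x]
        A.composition_rule[of x "inv\<^bsub>H\<^esub> k" "inv\<^bsub>H\<^esub> h"]
      by (auto simp: wreath_action_def H.inv_mult_group)
  qed
  have one: "?w \<one>\<^bsub>H\<^esub> f = f" if f: "f \<in> carrier ?N" for f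
  proof
    fix x
    show "?w \<one>\<^bsub>H\<^esub> f x = f x"
      using f A.id_eq_one[symmetric] by (auto simp: wreath_action_def carN PiE_iff extensional_def)
  qed
  have bij: "?w h \<in> Bij (carrier ?N)" if h: "h \<in> carrier H" for h
  proof -
    have "bij_betw (?w h) (carrier ?N) (carrier ?N)"
    proof (rule bij_betw_byWitness[where f' = "?w (inv\<^bsub>H\<^esub> h)"])
      show "\<forall>a\<in>carrier ?N. ?w (inv\<^bsub>H\<^esub> h) (?w h a) = a"
        using comp[of "inv\<^bsub>H\<^esub> h" h] one h by simp
      show "\<forall>a\<in>carrier ?N. ?w h (?w (inv\<^bsub>H\<^esub> h) a) = a"
        using comp[of h "inv\<^bsub>H\<^esub> h"] one h by simp
    qed (use cl h in auto)
    then show ?thesis by (auto simp: Bij_def wreath_action_def)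
  qed
  have aut: "?w h \<in> auto ?N" if h: "h \<in> carrier H" for h
  proof -
    have "?w h (f \<otimes>\<^bsub>?N\<^esub> g) = ?w h f \<otimes>\<^bsub>?N\<^esub> ?w h g"
      if f: "f \<in> carrier ?N" and g: "g \<in> carrier ?N" for f g
    proof -
      have "f \<otimes>\<^bsub>?N\<^esub> g \<in> carrier ?N"
        using f g sum_group[of X "\<lambda>_. G"] G by (metis group.is_monoid monoid.m_closed)
      then show ?thesis using f g h aX[of "inv\<^bsub>H\<^esub> h"] by (auto simp: wreath_action_def)
    qed
    then show ?thesis using cl[OF h] bij[OF h] by (auto simp: auto_def hom_def)
  qed
  show ?thesis
  proof (rule homI)
    fix h k assume h: "h \<in> carrier H" and k: "k \<in> carrier H"
    have "?w (h \<otimes>\<^bsub>H\<^esub> k) = compose (carrier ?N) (?w h) (?w k)"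
    proof
      fix f
      show "?w (h \<otimes>\<^bsub>H\<^esub> k) f = compose (carrier ?N) (?w h) (?w k) f"
        using comp[OF h k, of f] by (cases "f \<in> carrier ?N") (auto simp: compose_def wreath_action_def)
    qed
    then show "?w (h \<otimes>\<^bsub>H\<^esub> k) = ?w h \<otimes>\<^bsub>AutoGroup ?N\<^esub> ?w k"
      using bij h k by (simp add: AutoGroup_def BijGroup_def)
  qed (use aut in \<open>simp add: AutoGroup_def\<close>)
qed

lemma group_wreath_product:
  assumes "group G" "group H" "group_action H X \<alpha>"
  shows "group (wreath_product G X H \<alpha>)"
  unfolding wreath_product_def
  using assms by (intro group_semidirect_product wreath_action_hom) auto


section \<open>Isometric actions on ultrametric spaces and uncountable cofinality\<close>

locale Ultrametric_space = Metric_space +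
  assumes ultrametric: "\<And>x y z. \<lbrakk>x \<in> M; y \<in> M; z \<in> M\<rbrakk> \<Longrightarrow> d x y \<le> max (d x z) (d z y)"

definition isometric_action ::
    "('g, 'p) monoid_scheme \<Rightarrow> 'y set \<Rightarrow> ('y \<Rightarrow> 'y \<Rightarrow> real) \<Rightarrow> ('g \<Rightarrow> 'y \<Rightarrow> 'y) \<Rightarrow> bool"
  where "isometric_action G Y d \<phi> \<longleftrightarrow>
    group_action G Y \<phi> \<and>
    (\<forall>g \<in> carrier G. \<forall>x \<in> Y. \<forall>y \<in> Y. d (\<phi> g x) (\<phi> g y) = d x y)"

text \<open>
  A definition cannot quantify over all types, so the points of the ultrametric spaces
  below are taken from the type of sets of group elements. This is no restriction: every
  orbit is in bijection with the cosets of a stabilizer. The lemma following the definition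
  shows that boundedness of orbits carries over to ultrametric spaces over an arbitrary type.
\<close>

definition uncountable_cofinality :: "('g, 'p) monoid_scheme \<Rightarrow> bool"
  where "uncountable_cofinality G \<longleftrightarrow>
    (\<forall>(Y :: 'g set set) d \<phi>.
       Ultrametric_space Y d \<longrightarrow> isometric_action G Y d \<phi> \<longrightarrow>
       (\<forall>y \<in> Y. Metric_space.mbounded Y d (orbit G \<phi> y)))"

lemma uncountable_cofinality_bounded_orbit:
  fixes G :: "('g, 'p) monoid_scheme" and Y :: "'y set"
  assumes uc: "uncountable_cofinality G" and U: "Ultrametric_space Y d"
    and iso: "isometric_action G Y d \<phi>" and y: "y \<in> Y"
  shows "Metric_space.mbounded Y d (orbit G \<phi> y)"
proof -
  interpret U: Ultrametric_space Y d by fact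
  interpret A: group_action G Y \<phi> using iso by (simp add: isometric_action_def)
  interpret G: group G using A.group_hom by (simp add: group_hom_def)
  define O' where "O' = orbit G \<phi> y"
  define C where "C = (\<lambda>z. {g \<in> carrier G. \<phi> g y = z})"
  define p where "p = inv_into O' C"
  define Y' where "Y' = C ` O'"
  define d' where "d' = (\<lambda>a b. d (p a) (p b))"
  define \<psi> where "\<psi> = (\<lambda>g. \<lambda>a \<in> Y'. C (\<phi> g (p a)))"
  have O_sub: "O' \<subseteq> Y" using A.element_image y by (auto simp: O'_def orbit_def)
  have y_in: "y \<in> O'" using A.orbit_refl y by (simp add: O'_def)
  have inj: "inj_on C O'" by (rule inj_onI) (auto simp: C_def O'_def orbit_def)
  have pC: "p (C z) = z" if "z \<in> O'" for z using inj that by (simp add: p_def)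
  have O_cl: "\<phi> g z \<in> O'" if "g \<in> carrier G" "z \<in> O'" for g z
    using that y A.composition_rule[of y g, symmetric] by (auto simp: O'_def orbit_def)
  have psi: "\<psi> g (C z) = C (\<phi> g z)" if "z \<in> O'" for g z
    using that by (simp add: \<psi>_def Y'_def pC)
  have \<psi>_cl: "\<psi> g a \<in> Y'" if "g \<in> carrier G" "a \<in> Y'" for g a
    using that O_cl psi by (auto simp: Y'_def)
  have comp: "\<psi> (g \<otimes>\<^bsub>G\<^esub> h) a = \<psi> g (\<psi> h a)"
    if gha: "g \<in> carrier G" "h \<in> carrier G" "a \<in> Y'" for g h a
  proof -
    obtain z where z: "a = C z" "z \<in> O'" using gha by (auto simp: Y'_def)
    have "z \<in> Y" using z O_sub by auto
    then show ?thesis using z gha O_cl psi A.composition_rule[of z g h] by simp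
  qed
  have one: "\<psi> \<one>\<^bsub>G\<^esub> a = a" if a: "a \<in> Y'" for a
  proof -
    obtain z where z: "a = C z" "z \<in> O'" using a by (auto simp: Y'_def)
    have "z \<in> Y" using z O_sub by auto
    then show ?thesis using z psi A.id_eq_one[symmetric] by simp
  qed
  have bij: "\<psi> g \<in> Bij Y'" if g: "g \<in> carrier G" for g
  proof -
    have "bij_betw (\<psi> g) Y' Y'"
    proof (rule bij_betw_byWitness[where f' = "\<psi> (inv\<^bsub>G\<^esub> g)"])
      show "\<forall>a\<in>Y'. \<psi> (inv\<^bsub>G\<^esub> g) (\<psi> g a) = a"
        using comp[of "inv\<^bsub>G\<^esub> g" g] one g by simp
      show "\<forall>a\<in>Y'. \<psi> g (\<psi> (inv\<^bsub>G\<^esub> g) a) = a"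
        using comp[of g "inv\<^bsub>G\<^esub> g"] one g by simp
    qed (use \<psi>_cl g in auto)
    then show ?thesis by (simp add: Bij_def \<psi>_def)
  qed
  have act: "group_action G Y' \<psi>"
    unfolding group_action_def group_hom_def group_hom_axioms_def
  proof (intro conjI homI)
    fix g h assume g: "g \<in> carrier G" and h: "h \<in> carrier G"
    have "\<psi> (g \<otimes>\<^bsub>G\<^esub> h) = compose Y' (\<psi> g) (\<psi> h)"
    proof
      fix a
      show "\<psi> (g \<otimes>\<^bsub>G\<^esub> h) a = compose Y' (\<psi> g) (\<psi> h) a"
        using comp[OF g h, of a] by (cases "a \<in> Y'") (auto simp: compose_def \<psi>_def)
    qed
    then show "\<psi> (g \<otimes>\<^bsub>G\<^esub> h) = \<psi> g \<otimes>\<^bsub>BijGroup Y'\<^esub> \<psi> h"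
      using bij g h by (simp add: BijGroup_def)
  next
    show "\<psi> g \<in> carrier (BijGroup Y')" if "g \<in> carrier G" for g
      using bij[OF that] by (simp add: BijGroup_def)
  qed (rule G.is_group group_BijGroup)+
  have iso': "isometric_action G Y' d' \<psi>"
    using act iso O_cl psi pC O_sub
    by (auto simp: isometric_action_def Y'_def d'_def subset_eq)
  have U': "Ultrametric_space Y' d'"
  proof
    show "d' a b = d' b a" for a b by (simp add: d'_def U.commute)
    show "(d' a b = 0) = (a = b)" if "a \<in> Y'" "b \<in> Y'" for a b
      using that O_sub pC by (auto simp: Y'_def d'_def subset_eq)
    show "d' a c \<le> d' a b + d' b c" if "a \<in> Y'" "b \<in> Y'" "c \<in> Y'" for a b c
      using that O_sub pC U.triangle by (auto simp: Y'_def d'_def subset_eq)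
    show "d' a b \<le> max (d' a c) (d' c b)" if "a \<in> Y'" "b \<in> Y'" "c \<in> Y'" for a b c
      using that O_sub pC U.ultrametric by (auto simp: Y'_def d'_def subset_eq)
  qed (simp add: d'_def)
  interpret U': Ultrametric_space Y' d' by fact
  have "U'.mbounded (orbit G \<psi> (C y))"
    using uc U' iso' y_in by (auto simp: uncountable_cofinality_def Y'_def)
  moreover have "orbit G \<psi> (C y) = Y'"
    using psi[OF y_in] by (auto simp: Y'_def orbit_def O'_def)
  ultimately obtain B where B: "\<forall>a\<in>Y'. \<forall>b\<in>Y'. d' a b \<le> B"
    by (auto simp: U'.mbounded_alt)
  then have "\<forall>u\<in>O'. \<forall>v\<in>O'. d u v \<le> B" by (auto simp: Y'_def d'_def pC)
  then show ?thesis using O_sub unfolding O'_def[symmetric] U.mbounded_alt by blast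
qed

end

theory Submission
  imports Defs
begin

text \<open>
  An isometric action on an ultrametric space filters the group by the subgroups of elements
  that move a base point by at most \<open>n\<close>; conversely an exhaustion of the group by an increasing
  sequence of subgroups measures how late an element appears, which is an ultrametric length and
  hence a left-invariant ultrametric on the group itself. Thus a group has uncountable cofinality
  iff every increasing sequence of subgroups that exhausts it is eventually the whole group
  (\<open>uncountable_cofinality_if_exhaustions_stationary\<close> and
  \<open>exhaustion_stationary_if_uncountable_cofinality\<close>), and the rest of the argument is about such
  exhaustions. They pull back along homomorphisms, so a homomorphic image of a group of
  uncountable cofinality inside any group lies in one term of each exhaustion of the latter
  (\<open>uncountable_cofinality_hom_image\<close>).

  Let the wreath product \<open>W\<close> have uncountable cofinality. Its quotient \<open>H\<close> inherits the property.
  For \<open>G\<close> and for the orbits, choose subgroups \<open>K n x\<close> of \<open>G\<close> increasing in \<open>n\<close> and constant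
  along the orbits. The elements of \<open>W\<close> whose coordinate at each \<open>x\<close> lies in \<open>K n x\<close> form a
  subgroup, and these subgroups exhaust \<open>W\<close> as soon as \<open>K n x\<close> exhausts \<open>G\<close> for each \<open>x\<close>,
  because supports are finite. Hence one \<open>n\<close> has \<open>K n x = G\<close> for all \<open>x\<close> at once
  (\<open>fibrewise_exhaustion_stationary\<close>). If \<open>K n\<close> does not depend on \<open>x\<close>, this says that \<open>G\<close> has
  uncountable cofinality. If there were infinitely many orbits \<open>O\<^sub>0, O\<^sub>1, \<dots>\<close>, taking \<open>K n x\<close>
  trivial on the orbits \<open>O\<^sub>k\<close> with \<open>k \<ge> n\<close> and equal to \<open>G\<close> elsewhere would contradict that \<open>G\<close>
  is non-trivial.

  Conversely, \<open>W\<close> is generated by \<open>H\<close> and the copies of \<open>G\<close> at one representative of each orbit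
  (\<open>wreath_generation\<close>), because conjugation by \<open>H\<close> moves such a copy along its orbit. If
  there are finitely many orbits, these are finitely many subgroups; when each is the image of a
  group of uncountable cofinality, one term of any exhaustion contains all of them.
\<close>

section \<open>Uncountable cofinality and exhaustions by subgroups\<close>

definition exhaustion :: "('g, 'p) monoid_scheme \<Rightarrow> (nat \<Rightarrow> 'g set) \<Rightarrow> bool"
  where "exhaustion G A \<longleftrightarrow>
    (\<forall>n. subgroup (A n) G) \<and> mono A \<and> (\<Union>n. A n) = carrier G"

lemma exhaustionI:
  assumes "\<And>n. subgroup (A n) G" "\<And>n m. n \<le> m \<Longrightarrow> A n \<subseteq> A m"
    and "\<And>g. g \<in> carrier G \<Longrightarrow> \<exists>n. g \<in> A n"
  shows "exhaustion G A"
proof -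
  have "A n \<subseteq> carrier G" for n using assms(1) by (rule subgroup.subset)
  then have "(\<Union>n. A n) = carrier G" using assms(3) by auto
  then show ?thesis using assms(1,2) by (simp add: exhaustion_def mono_def)
qed

lemma exhaustionD:
  assumes "exhaustion G A"
  shows "subgroup (A n) G" "n \<le> m \<Longrightarrow> A n \<subseteq> A m" "g \<in> carrier G \<Longrightarrow> \<exists>n. g \<in> A n"
    "A n \<subseteq> carrier G"
  using assms by (auto simp: exhaustion_def dest: monoD)

text \<open>Let \<open>l g\<close> be the first stage \<open>n\<close> with \<open>g \<in> A n\<close>. Since the stages are nested subgroups,
  \<open>l (g\<^sup>-\<^sup>1h)\<close> is a left-invariant ultrametric on \<open>G\<close>, up to separating points. Left
  multiplication has a single orbit, so its boundedness bounds \<open>l\<close>.\<close>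

lemma exhaustion_stationary_if_uncountable_cofinality:
  assumes "group G" and uc: "uncountable_cofinality G" and ex: "exhaustion G A"
  shows "\<exists>n. A n = carrier G"
proof -
  interpret G: group G by fact
  interpret A: subgroup "A n" G for n using exhaustionD(1)[OF ex] .
  define l where "l g = (LEAST n. g \<in> A n)" for g
  have l_le: "l g \<le> n \<longleftrightarrow> g \<in> A n" if "g \<in> carrier G" for g n
  proof
    have "g \<in> A (l g)"
      unfolding l_def using exhaustionD(3)[OF ex that] by (rule LeastI_ex)
    then show "l g \<le> n \<Longrightarrow> g \<in> A n" using exhaustionD(2)[OF ex] by blast
  qed (simp add: l_def Least_le)
  have l_mult: "l (g \<otimes>\<^bsub>G\<^esub> h) \<le> max (l g) (l h)" if g: "g \<in> carrier G" and h: "h \<in> carrier G" for g h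
  proof -
    have "g \<in> A (max (l g) (l h))" "h \<in> A (max (l g) (l h))"
      using l_le g h max.cobounded1 max.cobounded2 by blast+
    then show ?thesis using l_le g h by auto
  qed
  \<comment> \<open>The successor separates points: elements of \<open>A 0\<close> have length \<open>0\<close> without being trivial.
    The maximum makes \<open>d\<close> symmetric off the carrier too, where inverses say nothing.\<close>
  define d :: "'a \<Rightarrow> 'a \<Rightarrow> real" where "d g h =
    (if g = h then 0 else real (Suc (max (l (inv\<^bsub>G\<^esub> g \<otimes>\<^bsub>G\<^esub> h)) (l (inv\<^bsub>G\<^esub> h \<otimes>\<^bsub>G\<^esub> g)))))" for g h
  have d_ultra: "d g h \<le> max (d g k) (d k h)"
    if "g \<in> carrier G" "h \<in> carrier G" "k \<in> carrier G" for g h k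
  proof -
    have tri: "l (inv\<^bsub>G\<^esub> a \<otimes>\<^bsub>G\<^esub> b) \<le> max (l (inv\<^bsub>G\<^esub> a \<otimes>\<^bsub>G\<^esub> k)) (l (inv\<^bsub>G\<^esub> k \<otimes>\<^bsub>G\<^esub> b))"
      if "a \<in> carrier G" "b \<in> carrier G" for a b
    proof -
      have "k \<otimes>\<^bsub>G\<^esub> (inv\<^bsub>G\<^esub> k \<otimes>\<^bsub>G\<^esub> b) = b"
        using that \<open>k \<in> carrier G\<close> by (simp flip: G.m_assoc)
      then have "(inv\<^bsub>G\<^esub> a \<otimes>\<^bsub>G\<^esub> k) \<otimes>\<^bsub>G\<^esub> (inv\<^bsub>G\<^esub> k \<otimes>\<^bsub>G\<^esub> b) = inv\<^bsub>G\<^esub> a \<otimes>\<^bsub>G\<^esub> b"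
        using that \<open>k \<in> carrier G\<close> by (simp add: G.m_assoc)
      then show ?thesis
        using l_mult[of "inv\<^bsub>G\<^esub> a \<otimes>\<^bsub>G\<^esub> k" "inv\<^bsub>G\<^esub> k \<otimes>\<^bsub>G\<^esub> b"] that \<open>k \<in> carrier G\<close> by simp
    qed
    show ?thesis using tri[OF that(1,2)] tri[OF that(2,1)] by (auto simp: d_def)
  qed
  have d_nonneg: "0 \<le> d g h" for g h by (simp add: d_def)
  interpret M: Ultrametric_space "carrier G" d
  proof
    show "d x y = d y x" for x y by (simp add: d_def max.commute)
    show "(d x y = 0) = (x = y)" for x y by (simp add: d_def)
    show "d x z \<le> d x y + d y z"
      if "x \<in> carrier G" "y \<in> carrier G" "z \<in> carrier G" for x y z
      using d_ultra[of x z y] that d_nonneg[of x y] d_nonneg[of y z] by linarith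
  qed (use d_nonneg d_ultra in auto)
  define \<phi> where "\<phi> g = (\<lambda>x \<in> carrier G. g \<otimes>\<^bsub>G\<^esub> x)" for g
  have bij: "\<phi> g \<in> Bij (carrier G)" if "g \<in> carrier G" for g
  proof -
    have "bij_betw (\<phi> g) (carrier G) (carrier G)"
      by (rule bij_betw_byWitness[where f' = "\<phi> (inv\<^bsub>G\<^esub> g)"])
        (use that in \<open>auto simp: \<phi>_def G.m_assoc[symmetric]\<close>)
    then show ?thesis by (simp add: Bij_def \<phi>_def)
  qed
  have "\<phi> \<in> hom G (BijGroup (carrier G))"
  proof (rule homI)
    fix g h assume gh: "g \<in> carrier G" "h \<in> carrier G"
    have "\<phi> (g \<otimes>\<^bsub>G\<^esub> h) = compose (carrier G) (\<phi> g) (\<phi> h)"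
      using gh by (auto simp: \<phi>_def compose_def G.m_assoc intro!: restrict_ext)
    then show "\<phi> (g \<otimes>\<^bsub>G\<^esub> h) = \<phi> g \<otimes>\<^bsub>BijGroup (carrier G)\<^esub> \<phi> h"
      using bij gh by (simp add: BijGroup_def)
  qed (use bij in \<open>simp add: BijGroup_def\<close>)
  then have "group_action G (carrier G) \<phi>"
    by (simp add: group_action_def group_hom_def group_hom_axioms_def group_BijGroup)
  moreover have "d (\<phi> g x) (\<phi> g y) = d x y"
    if "g \<in> carrier G" "x \<in> carrier G" "y \<in> carrier G" for g x y
  proof -
    have "inv\<^bsub>G\<^esub> (g \<otimes>\<^bsub>G\<^esub> a) \<otimes>\<^bsub>G\<^esub> (g \<otimes>\<^bsub>G\<^esub> b) = inv\<^bsub>G\<^esub> a \<otimes>\<^bsub>G\<^esub> b"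
      if "a \<in> carrier G" "b \<in> carrier G" for a b
    proof -
      have "inv\<^bsub>G\<^esub> g \<otimes>\<^bsub>G\<^esub> (g \<otimes>\<^bsub>G\<^esub> b) = b"
        using that \<open>g \<in> carrier G\<close> by (simp flip: G.m_assoc)
      then show ?thesis using that \<open>g \<in> carrier G\<close> by (simp add: G.inv_mult_group G.m_assoc)
    qed
    then show ?thesis using that by (simp add: d_def \<phi>_def)
  qed
  ultimately have "isometric_action G (carrier G) d \<phi>" by (simp add: isometric_action_def)
  then have "M.mbounded (orbit G \<phi> \<one>\<^bsub>G\<^esub>)"
    by (rule uncountable_cofinality_bounded_orbit[OF uc M.Ultrametric_space_axioms _ G.one_closed])
  moreover have "orbit G \<phi> \<one>\<^bsub>G\<^esub> = carrier G" 
    by (auto simp: orbit_def \<phi>_def intro: G.r_one[symmetric])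
  ultimately obtain B where B: "\<And>g. g \<in> carrier G \<Longrightarrow> d \<one>\<^bsub>G\<^esub> g \<le> B"
    unfolding M.mbounded_alt using G.one_closed by auto
  have "g \<in> A (nat \<lceil>B\<rceil>)" if g: "g \<in> carrier G" for g
  proof (cases "g = \<one>\<^bsub>G\<^esub>")
    case False
    then have "real (Suc (l g)) \<le> B" using B[OF g] g by (auto simp: d_def max_def split: if_splits)
    then have "l g \<le> nat \<lceil>B\<rceil>" by linarith
    then show ?thesis using l_le[OF g] by blast
  qed simp
  then show ?thesis using exhaustionD(4)[OF ex] by blast
qed

text \<open>The ultrametric inequality is what makes the elements that move \<open>y\<close> by at most \<open>n\<close>
  closed under products; in a general metric space the displacements would add up.\<close>

lemma uncountable_cofinality_if_exhaustions_stationary: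
  assumes "group G" and st: "\<And>A. exhaustion G A \<Longrightarrow> \<exists>n. A n = carrier G"
  shows "uncountable_cofinality G"
  unfolding uncountable_cofinality_def
proof (intro allI impI ballI)
  fix Y :: "'a set set" and d \<phi> y
  assume "Ultrametric_space Y d" and iso: "isometric_action G Y d \<phi>" and y: "y \<in> Y"
  interpret G: group G by fact
  interpret M: Ultrametric_space Y d by fact
  interpret A: group_action G Y \<phi> using iso by (simp add: isometric_action_def)
  have isom: "d (\<phi> g u) (\<phi> g v) = d u v" if "g \<in> carrier G" "u \<in> Y" "v \<in> Y" for g u v
    using iso that by (simp add: isometric_action_def)
  have cl: "\<phi> g u \<in> Y" if "g \<in> carrier G" "u \<in> Y" for g u
    using A.element_image that by blast
  have one: "\<phi> \<one>\<^bsub>G\<^esub> y = y" using A.id_eq_one[symmetric] y by simp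
  define S where "S n = {g \<in> carrier G. d (\<phi> g y) y \<le> real n}" for n :: nat
  have "exhaustion G S"
  proof (rule exhaustionI)
    fix n
    show "subgroup (S n) G"
    proof (rule G.subgroupI)
      show "S n \<noteq> {}" using one y by (auto simp: S_def intro!: exI[of _ "\<one>\<^bsub>G\<^esub>"])
    next
      fix g assume g: "g \<in> S n"
      then have gG: "g \<in> carrier G" by (simp add: S_def)
      have "d (\<phi> (inv\<^bsub>G\<^esub> g) y) y = d (\<phi> g (\<phi> (inv\<^bsub>G\<^esub> g) y)) (\<phi> g y)"
        using isom[OF gG] cl gG y by simp
      also have "\<phi> g (\<phi> (inv\<^bsub>G\<^esub> g) y) = y"
        using A.composition_rule[OF y, of g "inv\<^bsub>G\<^esub> g"] one gG by simp
      finally show "inv\<^bsub>G\<^esub> g \<in> S n" using g M.commute by (simp add: S_def)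
    next
      fix g h assume "g \<in> S n" "h \<in> S n"
      then have gh: "g \<in> carrier G" "h \<in> carrier G" "d (\<phi> g y) y \<le> n" "d (\<phi> h y) y \<le> n"
        by (auto simp: S_def)
      have "d (\<phi> g (\<phi> h y)) y \<le> max (d (\<phi> g (\<phi> h y)) (\<phi> g y)) (d (\<phi> g y) y)"
        using gh y cl by (intro M.ultrametric) auto
      also have "\<dots> \<le> n" using gh isom cl y by simp
      finally show "g \<otimes>\<^bsub>G\<^esub> h \<in> S n"
        using gh A.composition_rule[OF y] by (simp add: S_def)
    qed (auto simp: S_def)
  next
    show "\<exists>n. g \<in> S n" if "g \<in> carrier G" for g
      using that real_arch_simple by (auto simp: S_def)
  qed (force simp: S_def)
  then obtain n where "S n = carrier G" using st by blast
  then have "d (\<phi> g y) y \<le> n" if "g \<in> carrier G" for g using that by (auto simp: S_def)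
  then have "orbit G \<phi> y \<subseteq> M.mcball y n"
    using y cl M.commute by (auto simp: orbit_def M.in_mcball)
  then show "M.mbounded (orbit G \<phi> y)" unfolding M.mbounded_def by blast
qed

lemma exhaustion_vimage:
  assumes "group_hom G K \<phi>" and ex: "exhaustion K B"
  shows "exhaustion G (\<lambda>n. {g \<in> carrier G. \<phi> g \<in> B n})"
proof -
  interpret group_hom G K \<phi> by fact
  show ?thesis
  proof (rule exhaustionI)
    fix n
    interpret B: subgroup "B n" K using exhaustionD(1)[OF ex] .
    show "subgroup {g \<in> carrier G. \<phi> g \<in> B n} G"
      by (rule G.subgroupI) (auto intro!: exI[of _ "\<one>\<^bsub>G\<^esub>"])
  qed (use exhaustionD[OF ex] in \<open>auto simp: subset_eq\<close>)
qed

lemma uncountable_cofinality_hom_image: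
  assumes "uncountable_cofinality G" and hom: "group_hom G K \<phi>" and "exhaustion K B"
  shows "\<exists>n. \<phi> ` carrier G \<subseteq> B n"
proof -
  have "group G" using hom by (simp add: group_hom_def)
  then obtain n where "{g \<in> carrier G. \<phi> g \<in> B n} = carrier G"
    using exhaustion_stationary_if_uncountable_cofinality[OF _ assms(1) exhaustion_vimage[OF assms(2,3)]]
    by auto
  then show ?thesis by blast
qed

lemma uncountable_cofinality_quotient:
  assumes "uncountable_cofinality G" "group_hom G K \<phi>" "\<phi> ` carrier G = carrier K"
  shows "uncountable_cofinality K"
proof (rule uncountable_cofinality_if_exhaustions_stationary)
  show "group K" using assms(2) by (simp add: group_hom_def)
  show "\<exists>n. B n = carrier K" if "exhaustion K B" for B
    using uncountable_cofinality_hom_image[OF assms(1,2) that] assms(3) exhaustionD(4)[OF that]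
    by blast
qed

section \<open>Coordinates in restricted sums and wreath products\<close>

text \<open>The default value \<open>undefined\<close> off \<open>X\<close> makes this an element of the carrier of the sum,
  whose elements are extensional.\<close>

definition lamp :: "('g, 'p) monoid_scheme \<Rightarrow> 'x set \<Rightarrow> 'x \<Rightarrow> 'g \<Rightarrow> 'x \<Rightarrow> 'g"
  where "lamp G X x g = (\<lambda>y \<in> X. if y = x then g else \<one>\<^bsub>G\<^esub>)"

lemma carrier_sum_group_const:
  assumes "group G"
  shows "carrier (sum_group X (\<lambda>_. G)) =
    {f \<in> X \<rightarrow>\<^sub>E carrier G. finite {x \<in> X. f x \<noteq> \<one>\<^bsub>G\<^esub>}}"
  using carrier_sum_group[of X "\<lambda>_. G"] assms by simp

lemma lamp_in_sum_group:
  assumes "group G" "g \<in> carrier G"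
  shows "lamp G X x g \<in> carrier (sum_group X (\<lambda>_. G))"
proof -
  interpret group G by fact
  have "{y \<in> X. lamp G X x g y \<noteq> \<one>\<^bsub>G\<^esub>} \<subseteq> {x}" by (auto simp: lamp_def)
  then have "finite {y \<in> X. lamp G X x g y \<noteq> \<one>\<^bsub>G\<^esub>}" by (rule finite_subset) simp
  moreover have "lamp G X x g \<in> X \<rightarrow>\<^sub>E carrier G" using assms by (auto simp: lamp_def)
  ultimately show ?thesis using carrier_sum_group_const[OF assms(1)] by blast
qed

text \<open>An element is the product of the lamps at the finitely many points of its support.\<close>

lemma lamps_generate_sum_group:
  assumes "group G" and K: "subgroup K (sum_group X (\<lambda>_. G))"
    and lamps: "\<And>x g. x \<in> X \<Longrightarrow> g \<in> carrier G \<Longrightarrow> lamp G X x g \<in> K"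
  shows "carrier (sum_group X (\<lambda>_. G)) \<subseteq> K"
proof
  interpret G: group G by fact
  let ?N = "sum_group X (\<lambda>_. G)"
  interpret K: subgroup K ?N by fact
  note carN = carrier_sum_group_const[OF \<open>group G\<close>, of X]
  have main: "f \<in> K" if "finite S" "f \<in> carrier ?N" "{x \<in> X. f x \<noteq> \<one>\<^bsub>G\<^esub>} \<subseteq> S" for S f
    using that
  proof (induction S arbitrary: f rule: finite_induct)
    case empty
    then have "f = \<one>\<^bsub>?N\<^esub>" by (auto simp: carN PiE_iff extensional_def)
    then show ?case using K.one_closed by metis
  next
    case (insert x S)
    show ?case
    proof (cases "x \<in> X")
      case True
      \<comment> \<open>Split off the coordinate at \<open>x\<close>.\<close>
      let ?f = "\<lambda>y \<in> X. if y = x then \<one>\<^bsub>G\<^esub> else f y"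
      have fX: "f y \<in> carrier G" if "y \<in> X" for y
        using insert.prems that by (auto simp: carN)
      have supp: "{y \<in> X. ?f y \<noteq> \<one>\<^bsub>G\<^esub>} \<subseteq> S" using insert.prems by auto
      moreover from this have "?f \<in> carrier ?N"
        using fX finite_subset[OF supp \<open>finite S\<close>] by (auto simp: carN cong: conj_cong)
      ultimately have f: "?f \<in> K" using insert.IH by blast
      have "f = lamp G X x (f x) \<otimes>\<^bsub>?N\<^esub> ?f"
        using insert.prems True fX by (auto simp: carN PiE_iff extensional_def lamp_def)
      then show ?thesis using K.m_closed[OF lamps[OF True fX[OF True]] f] by (simp only:)
    qed (use insert in auto)
  qed
  show "f \<in> K" if "f \<in> carrier ?N" for f
    using main[of "{x \<in> X. f x \<noteq> \<one>\<^bsub>G\<^esub>}" f] that by (simp add: carN)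
qed

locale permutational_wreath = G: group G + A: group_action H X \<alpha>
  for G :: "('g, 'p) monoid_scheme" and H :: "('h, 'q) monoid_scheme"
    and X :: "'x set" and \<alpha> :: "'h \<Rightarrow> 'x \<Rightarrow> 'x"
begin

sublocale H: group H
  using A.group_hom by (simp add: group_hom_def)

abbreviation N where "N \<equiv> sum_group X (\<lambda>_. G)"
abbreviation W where "W \<equiv> wreath_product G X H \<alpha>"

sublocale N: group N by simp

sublocale W: group W
  by (intro group_wreath_product G.is_group H.is_group A.group_action_axioms)

lemmas carrier_N = carrier_sum_group_const[OF G.is_group, of X]

lemma carrier_W: "carrier W = carrier N \<times> carrier H"
  by (simp add: wreath_product_def semidirect_product_def)

lemma one_W: "\<one>\<^bsub>W\<^esub> = (\<one>\<^bsub>N\<^esub>, \<one>\<^bsub>H\<^esub>)"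
  by (simp add: wreath_product_def semidirect_product_def)

lemma mult_W:
  assumes "f' \<in> carrier N"
  shows "(f, h) \<otimes>\<^bsub>W\<^esub> (f', h') =
    (\<lambda>x \<in> X. f x \<otimes>\<^bsub>G\<^esub> f' (\<alpha> (inv\<^bsub>H\<^esub> h) x), h \<otimes>\<^bsub>H\<^esub> h')"
  using assms
  by (auto simp: wreath_product_def semidirect_product_def wreath_action_def intro!: restrict_ext)

lemma action_closed: "h \<in> carrier H \<Longrightarrow> x \<in> X \<Longrightarrow> \<alpha> h x \<in> X"
  using A.element_image by blast

lemma action_one: "x \<in> X \<Longrightarrow> \<alpha> \<one>\<^bsub>H\<^esub> x = x"
  using A.id_eq_one[symmetric] by simp

lemma action_eq_iff:
  assumes "h \<in> carrier H" "x \<in> X" "y \<in> X"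
  shows "\<alpha> (inv\<^bsub>H\<^esub> h) y = x \<longleftrightarrow> y = \<alpha> h x"
  using A.orbit_sym_aux[of h x y] A.orbit_sym_aux[of "inv\<^bsub>H\<^esub> h" y x] assms by auto

lemma projection_hom: "group_hom W H snd"
  by unfold_locales
    (auto simp: hom_def carrier_W wreath_product_def semidirect_product_def)

lemma acting_group_hom: "group_hom H W (\<lambda>h. (\<one>\<^bsub>N\<^esub>, h))"
proof unfold_locales
  show "(\<lambda>h. (\<one>\<^bsub>N\<^esub>, h)) \<in> hom H W"
  proof (rule homI)
    fix h k assume "h \<in> carrier H" "k \<in> carrier H"
    then show "(\<one>\<^bsub>N\<^esub>, h \<otimes>\<^bsub>H\<^esub> k) = (\<one>\<^bsub>N\<^esub>, h) \<otimes>\<^bsub>W\<^esub> (\<one>\<^bsub>N\<^esub>, k)"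
      using action_closed[of "inv\<^bsub>H\<^esub> h"]
      by (subst mult_W[OF N.one_closed]) (auto intro!: restrict_ext)
  next
    show "(\<one>\<^bsub>N\<^esub>, h) \<in> carrier W" if "h \<in> carrier H" for h
      unfolding carrier_W using N.one_closed that by (rule SigmaI)
  qed
qed

lemma base_hom: "group_hom N W (\<lambda>f. (f, \<one>\<^bsub>H\<^esub>))"
proof unfold_locales
  show "(\<lambda>f. (f, \<one>\<^bsub>H\<^esub>)) \<in> hom N W"
    by (rule homI) (auto simp: carrier_W mult_W action_one intro!: restrict_ext)
qed

lemma lamp_hom: "group_hom G W (\<lambda>g. (lamp G X x g, \<one>\<^bsub>H\<^esub>))"
proof -
  have "lamp G X x \<in> hom G N"
  proof (rule homI)
    show "lamp G X x g \<in> carrier N" if "g \<in> carrier G" for g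
      using lamp_in_sum_group[OF G.is_group that] .
  qed (auto simp: lamp_def)
  then have "(\<lambda>f. (f, \<one>\<^bsub>H\<^esub>)) \<circ> lamp G X x \<in> hom G W"
    using group_hom.homh[OF base_hom] by (rule hom_compose)
  then show ?thesis by unfold_locales (simp add: comp_def)
qed

text \<open>Stated without inverses in \<open>W\<close>: conjugation by \<open>h\<close> moves the lamp from \<open>x\<close> to \<open>\<alpha> h x\<close>.\<close>

lemma lamp_conjugate:
  assumes h: "h \<in> carrier H" and x: "x \<in> X" and g: "g \<in> carrier G"
  shows "(\<one>\<^bsub>N\<^esub>, h) \<otimes>\<^bsub>W\<^esub> (lamp G X x g, \<one>\<^bsub>H\<^esub>) = (lamp G X (\<alpha> h x) g, \<one>\<^bsub>H\<^esub>) \<otimes>\<^bsub>W\<^esub> (\<one>\<^bsub>N\<^esub>, h)"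
proof -
  have "\<alpha> (inv\<^bsub>H\<^esub> h) y \<in> X" if "y \<in> X" for y using action_closed that h by simp
  then show ?thesis
    using mult_W[OF N.one_closed] mult_W[OF lamp_in_sum_group[OF G.is_group g]] h x g
    by (auto simp: lamp_def action_eq_iff action_one intro!: restrict_ext)
qed

section \<open>Descending from the wreath product\<close>

text \<open>The product in \<open>W\<close> combines the coordinate of one factor at \<open>x\<close> with that of the other at a
  point of the same orbit, so \<open>K\<close> has to be constant along orbits.\<close>

lemma fibrewise_subgroup:
  assumes K: "\<And>x. x \<in> X \<Longrightarrow> subgroup (K x) G"
    and inv: "\<And>h x. h \<in> carrier H \<Longrightarrow> x \<in> X \<Longrightarrow> K (\<alpha> h x) = K x"
  shows "subgroup {w \<in> carrier W. \<forall>x \<in> X. fst w x \<in> K x} W"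
proof (rule W.subgroupI)
  have "\<forall>x \<in> X. fst \<one>\<^bsub>W\<^esub> x \<in> K x" using subgroup.one_closed[OF K] by (simp add: one_W)
  then show "{w \<in> carrier W. \<forall>x \<in> X. fst w x \<in> K x} \<noteq> {}" using W.one_closed by blast
next
  fix w assume "w \<in> {w \<in> carrier W. \<forall>x \<in> X. fst w x \<in> K x}"
  then obtain f h where w: "w = (f, h)" "w \<in> carrier W" "f \<in> carrier N" "h \<in> carrier H"
    and fK: "\<And>x. x \<in> X \<Longrightarrow> f x \<in> K x"
    by (auto simp: carrier_W)
  obtain f' h' where w': "inv\<^bsub>W\<^esub> w = (f', h')" "f' \<in> carrier N" "h' \<in> carrier H"
    using W.inv_closed[OF w(2)] by (auto simp: carrier_W)
  \<comment> \<open>The first component of \<open>w\<^sup>-\<^sup>1 w = 1\<close> gives \<open>f'\<close> in terms of a translate of \<open>f\<close>.\<close>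
  have "f' x \<in> K x" if x: "x \<in> X" for x
  proof -
    let ?y = "\<alpha> (inv\<^bsub>H\<^esub> h') x"
    interpret Kx: subgroup "K x" G using K[OF x] .
    have y: "?y \<in> X" using action_closed w' x by simp
    have "f ?y \<in> K x" using fK[OF y] inv[of "inv\<^bsub>H\<^esub> h'" x] w' x by simp
    moreover have "(f', h') \<otimes>\<^bsub>W\<^esub> (f, h) = \<one>\<^bsub>W\<^esub>"
      using W.l_inv[OF w(2)] w w' by simp
    then have "f' x \<otimes>\<^bsub>G\<^esub> f ?y = \<one>\<^bsub>G\<^esub>"
      using x w by (auto simp: mult_W one_W dest: fun_cong[where x = x])
    then have "f' x = inv\<^bsub>G\<^esub> (f ?y)"
      using w(3) w'(2) x y by (intro G.inv_equality[symmetric]) (auto simp: carrier_N)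
    ultimately show ?thesis by auto
  qed
  then show "inv\<^bsub>W\<^esub> w \<in> {w \<in> carrier W. \<forall>x \<in> X. fst w x \<in> K x}"
    using w w' by (auto simp: carrier_W)
next
  fix v w
  assume v: "v \<in> {w \<in> carrier W. \<forall>x \<in> X. fst w x \<in> K x}"
    and w: "w \<in> {w \<in> carrier W. \<forall>x \<in> X. fst w x \<in> K x}"
  obtain f h f' h' where vw: "v = (f, h)" "w = (f', h')" "h \<in> carrier H" "f' \<in> carrier N"
    using v w by (auto simp: carrier_W)
  have "f x \<otimes>\<^bsub>G\<^esub> f' (\<alpha> (inv\<^bsub>H\<^esub> h) x) \<in> K x" if x: "x \<in> X" for x
  proof -
    have "f' (\<alpha> (inv\<^bsub>H\<^esub> h) x) \<in> K x"
      using w vw x inv[of "inv\<^bsub>H\<^esub> h" x] action_closed[of "inv\<^bsub>H\<^esub> h" x] by auto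
    then show ?thesis using v vw x subgroup.m_closed[OF K[OF x]] by auto
  qed
  then show "v \<otimes>\<^bsub>W\<^esub> w \<in> {w \<in> carrier W. \<forall>x \<in> X. fst w x \<in> K x}"
    using W.m_closed[of v w] v w vw by (auto simp: mult_W)
qed auto

text \<open>The supports are finite, so the coordinates of an element lie in the fibres \<open>K n x\<close> for one
  common \<open>n\<close>: the maximum over the support of the stages at which they appear.\<close>

lemma fibrewise_exhaustion_stationary:
  assumes uc: "uncountable_cofinality W"
    and K: "\<And>x. x \<in> X \<Longrightarrow> exhaustion G (\<lambda>n. K n x)"
    and inv: "\<And>n h x. h \<in> carrier H \<Longrightarrow> x \<in> X \<Longrightarrow> K n (\<alpha> h x) = K n x"
  shows "\<exists>n. \<forall>x \<in> X. K n x = carrier G"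
proof -
  let ?B = "\<lambda>n. {w \<in> carrier W. \<forall>x \<in> X. fst w x \<in> K n x}"
  have "exhaustion W ?B"
  proof (rule exhaustionI)
    show "subgroup (?B n) W" for n
      using exhaustionD(1)[OF K] inv by (intro fibrewise_subgroup) auto
    show "?B n \<subseteq> ?B m" if "n \<le> m" for n m
      using exhaustionD(2)[OF K that] by blast
    fix w assume w: "w \<in> carrier W"
    let ?S = "{x \<in> X. fst w x \<noteq> \<one>\<^bsub>G\<^esub>}"
    have S: "finite ?S" and val: "\<And>x. x \<in> X \<Longrightarrow> fst w x \<in> carrier G"
      using w by (auto simp: carrier_W carrier_N)
    have "\<forall>x \<in> X. \<exists>n. fst w x \<in> K n x" using exhaustionD(3)[OF K val] by blast
    then obtain s where s: "\<And>x. x \<in> X \<Longrightarrow> fst w x \<in> K (s x) x" by metis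
    obtain n where n: "\<And>x. x \<in> ?S \<Longrightarrow> s x \<le> n"
      using S finite_nat_set_iff_bounded_le[of "s ` ?S"] by auto
    have "fst w x \<in> K n x" if x: "x \<in> X" for x
    proof (cases "fst w x = \<one>\<^bsub>G\<^esub>")
      case True
      then show ?thesis using subgroup.one_closed[OF exhaustionD(1)[OF K[OF x]]] by metis
    next
      case False
      then show ?thesis using s[OF x] exhaustionD(2)[OF K[OF x] n] x by blast
    qed
    then show "\<exists>n. w \<in> ?B n" using w by blast
  qed
  then obtain n where n: "?B n = carrier W"
    using exhaustion_stationary_if_uncountable_cofinality[OF W.is_group uc] by blast
  have "g \<in> K n x" if "x \<in> X" "g \<in> carrier G" for x g
  proof -
    have "(lamp G X x g, \<one>\<^bsub>H\<^esub>) \<in> ?B n"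
      unfolding n using lamp_in_sum_group[OF G.is_group that(2)] by (simp add: carrier_W)
    then show ?thesis using that by (auto simp: lamp_def)
  qed
  then show ?thesis using exhaustionD(4)[OF K] by blast
qed

lemma uncountable_cofinality_lamp_group:
  assumes "uncountable_cofinality W" "X \<noteq> {}"
  shows "uncountable_cofinality G"
proof (rule uncountable_cofinality_if_exhaustions_stationary)
  show "\<exists>n. A n = carrier G" if "exhaustion G A" for A
    using fibrewise_exhaustion_stationary[OF assms(1), of "\<lambda>n _. A n"] that assms(2) by auto
qed simp

lemma uncountable_cofinality_acting_group:
  assumes "uncountable_cofinality W"
  shows "uncountable_cofinality H"
proof (rule uncountable_cofinality_quotient[OF assms projection_hom])
  show "snd ` carrier W = carrier H" using N.one_closed by (force simp: carrier_W)
qed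

text \<open>With infinitely many orbits, one could exhaust \<open>W\<close> by forbidding non-trivial coordinates on
  all but ever more of a sequence of distinct orbits.\<close>

lemma finite_orbits:
  assumes uc: "uncountable_cofinality W" and nontriv: "carrier G \<noteq> {\<one>\<^bsub>G\<^esub>}"
  shows "finite (orbits H X \<alpha>)"
proof (rule ccontr)
  assume "infinite (orbits H X \<alpha>)"
  then obtain orb :: "nat \<Rightarrow> 'x set" where inj: "inj orb" and orb: "range orb \<subseteq> orbits H X \<alpha>"
    using infinite_countable_subset by blast
  have orbit_inv: "orbit H \<alpha> (\<alpha> h x) = orbit H \<alpha> x" if h: "h \<in> carrier H" and x: "x \<in> X" for h x
  proof
    have y: "\<alpha> h x \<in> X" using action_closed h x .
    have yx: "\<alpha> h x \<in> orbit H \<alpha> x" using h by (auto simp: orbit_def)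
    show "orbit H \<alpha> (\<alpha> h x) \<subseteq> orbit H \<alpha> x"
    proof
      fix z assume z: "z \<in> orbit H \<alpha> (\<alpha> h x)"
      then have "z \<in> X" using y action_closed by (auto simp: orbit_def)
      then show "z \<in> orbit H \<alpha> x" using A.orbit_trans[OF x y] yx z by blast
    qed
    show "orbit H \<alpha> x \<subseteq> orbit H \<alpha> (\<alpha> h x)"
    proof
      fix z assume z: "z \<in> orbit H \<alpha> x"
      then have "z \<in> X" using x action_closed by (auto simp: orbit_def)
      then show "z \<in> orbit H \<alpha> (\<alpha> h x)"
        using A.orbit_trans[OF y x] A.orbit_sym[OF x y yx] z by blast
    qed
  qed
  define K where
    "K n x = (if \<exists>k\<ge>n. orbit H \<alpha> x = orb k then {\<one>\<^bsub>G\<^esub>} else carrier G)" for n :: nat and x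
  have "\<exists>n. \<forall>x \<in> X. K n x = carrier G"
  proof (rule fibrewise_exhaustion_stationary[OF uc])
    fix x assume x: "x \<in> X"
    show "exhaustion G (\<lambda>n. K n x)"
    proof (rule exhaustionI)
      show "subgroup (K n x) G" for n
        by (simp add: K_def G.triv_subgroup G.subgroup_self)
      show "K n x \<subseteq> K m x" if "n \<le> m" for n m
        using that by (auto simp: K_def dest: order_trans)
      fix g assume g: "g \<in> carrier G"
      \<comment> \<open>As \<open>orb\<close> is injective, the orbit of \<open>x\<close> is \<open>orb k\<close> for at most one \<open>k\<close>,
        and from stage \<open>Suc k\<close> on \<open>K n x\<close> is everything.\<close>
      have "\<exists>n. \<forall>k\<ge>n. orbit H \<alpha> x \<noteq> orb k"
        using inj by (metis injD not_less_eq_eq order_refl)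
      then show "\<exists>n. g \<in> K n x" using g by (auto simp: K_def)
    qed
  qed (simp add: K_def orbit_inv)
  then obtain n where n: "\<And>x. x \<in> X \<Longrightarrow> K n x = carrier G" by blast
  obtain x where "x \<in> X" "orbit H \<alpha> x = orb n"
    using orb by (force simp: orbits_def)
  then have "K n x = {\<one>\<^bsub>G\<^esub>}" by (auto simp: K_def)
  then show False using n[OF \<open>x \<in> X\<close>] nontriv by simp
qed

section \<open>Ascending to the wreath product\<close>

text \<open>Conjugating by \<open>H\<close> spreads the lamps at the points \<open>y\<close> over their orbits, all lamps
  generate the base group, and every element is \<open>(f, h) = (f, 1)(1, h)\<close>.\<close>

lemma wreath_generation:
  assumes "subgroup B W" and H: "\<And>h. h \<in> carrier H \<Longrightarrow> (\<one>\<^bsub>N\<^esub>, h) \<in> B"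
    and reps: "\<And>x. x \<in> X \<Longrightarrow> \<exists>y \<in> X. x \<in> orbit H \<alpha> y \<and> (\<forall>g \<in> carrier G. (lamp G X y g, \<one>\<^bsub>H\<^esub>) \<in> B)"
  shows "B = carrier W"
proof -
  interpret B: subgroup B W by fact
  interpret base: group_hom N W "\<lambda>f. (f, \<one>\<^bsub>H\<^esub>)" by (rule base_hom)
  let ?K = "{f \<in> carrier N. (f, \<one>\<^bsub>H\<^esub>) \<in> B}"
  have lampB: "(lamp G X x g, \<one>\<^bsub>H\<^esub>) \<in> B" if x: "x \<in> X" and g: "g \<in> carrier G" for x g
  proof -
    obtain y h where y: "y \<in> X" "(lamp G X y g, \<one>\<^bsub>H\<^esub>) \<in> B" and h: "h \<in> carrier H" "x = \<alpha> h y"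
      using reps[OF x] g by (auto simp: orbit_def)
    let ?h = "(\<one>\<^bsub>N\<^esub>, h)" and ?l = "(lamp G X x g, \<one>\<^bsub>H\<^esub>)"
    have l: "?l \<in> carrier W"
      using lamp_in_sum_group[OF G.is_group g] by (simp add: carrier_W)
    have hB: "?h \<in> B" using H[OF h(1)] .
    have "?l \<otimes>\<^bsub>W\<^esub> ?h \<in> B"
      using lamp_conjugate[OF h(1) y(1) g] B.m_closed[OF hB y(2)] h(2) by metis
    then have "(?l \<otimes>\<^bsub>W\<^esub> ?h) \<otimes>\<^bsub>W\<^esub> inv\<^bsub>W\<^esub> ?h \<in> B" using hB by blast
    moreover have "(?l \<otimes>\<^bsub>W\<^esub> ?h) \<otimes>\<^bsub>W\<^esub> inv\<^bsub>W\<^esub> ?h = ?l"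
      using W.m_assoc[OF l, of ?h "inv\<^bsub>W\<^esub> ?h"] l B.mem_carrier[OF hB]
      by (simp del: one_sum_group)
    ultimately show ?thesis by (simp only:)
  qed
  have "subgroup ?K N"
  proof (rule N.subgroupI)
    show "?K \<noteq> {}" using N.one_closed base.hom_one B.one_closed by fastforce
    show "inv\<^bsub>N\<^esub> f \<in> ?K" if "f \<in> ?K" for f
      using that base.hom_inv[of f] B.m_inv_closed[of "(f, \<one>\<^bsub>H\<^esub>)"] N.inv_closed[of f] by auto
    show "f \<otimes>\<^bsub>N\<^esub> g \<in> ?K" if "f \<in> ?K" "g \<in> ?K" for f g
      using that base.hom_mult[of f g] B.m_closed[of "(f, \<one>\<^bsub>H\<^esub>)" "(g, \<one>\<^bsub>H\<^esub>)"] N.m_closed[of f g]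
      by (auto simp del: mult_sum_group)
  qed auto
  then have N: "carrier N \<subseteq> ?K"
    using lampB lamp_in_sum_group[OF G.is_group]
    by (intro lamps_generate_sum_group[OF G.is_group]) auto
  have "(f, h) \<in> B" if fh: "f \<in> carrier N" "h \<in> carrier H" for f h
  proof -
    have "(f, \<one>\<^bsub>H\<^esub>) \<otimes>\<^bsub>W\<^esub> (\<one>\<^bsub>N\<^esub>, h) = (f, h)"
      using mult_W[OF N.one_closed] fh
      by (auto simp: action_one carrier_N PiE_iff extensional_def)
    then show ?thesis using B.m_closed[of "(f, \<one>\<^bsub>H\<^esub>)" "(\<one>\<^bsub>N\<^esub>, h)"] N H fh by auto
  qed
  then show ?thesis using B.subset by (auto simp: carrier_W)
qed

lemma uncountable_cofinality_wreath:
  assumes ucG: "uncountable_cofinality G" and ucH: "uncountable_cofinality H"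
    and fin: "finite (orbits H X \<alpha>)"
  shows "uncountable_cofinality W"
proof (rule uncountable_cofinality_if_exhaustions_stationary[OF W.is_group])
  fix B assume B: "exhaustion W B"
  obtain m where m: "\<And>h. h \<in> carrier H \<Longrightarrow> (\<one>\<^bsub>N\<^esub>, h) \<in> B m"
    using uncountable_cofinality_hom_image[OF ucH acting_group_hom B] by blast
  obtain R where R: "finite R" "R \<subseteq> X" "orbits H X \<alpha> = orbit H \<alpha> ` R"
  proof -
    have "orbits H X \<alpha> \<subseteq> orbit H \<alpha> ` X" by (auto simp: orbits_def)
    then show thesis using finite_subset_image[OF fin] that by metis
  qed
  have "\<exists>n. (\<lambda>g. (lamp G X x g, \<one>\<^bsub>H\<^esub>)) ` carrier G \<subseteq> B n" for x
    using uncountable_cofinality_hom_image[OF ucG lamp_hom B] .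
  then obtain s where s: "\<And>x g. g \<in> carrier G \<Longrightarrow> (lamp G X x g, \<one>\<^bsub>H\<^esub>) \<in> B (s x)"
    by (metis image_subset_iff)
  obtain k where k: "\<And>x. x \<in> R \<Longrightarrow> s x \<le> k"
    using R(1) finite_nat_set_iff_bounded_le[of "s ` R"] by auto
  have "B (max m k) = carrier W"
  proof (rule wreath_generation[OF exhaustionD(1)[OF B]])
    show "(\<one>\<^bsub>N\<^esub>, h) \<in> B (max m k)" if "h \<in> carrier H" for h
      using m[OF that] exhaustionD(2)[OF B, of m "max m k"] by auto
    fix x assume x: "x \<in> X"
    then have "orbit H \<alpha> x \<in> orbits H X \<alpha>" by (auto simp: orbits_def)
    then obtain y where y: "y \<in> R" "orbit H \<alpha> x = orbit H \<alpha> y" using R(3) by auto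
    then have "x \<in> orbit H \<alpha> y" using A.orbit_refl[OF x] by simp
    moreover have "(lamp G X y g, \<one>\<^bsub>H\<^esub>) \<in> B (max m k)" if "g \<in> carrier G" for g
      using s[OF that] exhaustionD(2)[OF B, of "s y" "max m k"] k[OF y(1)] by fastforce
    ultimately show
      "\<exists>y \<in> X. x \<in> orbit H \<alpha> y \<and> (\<forall>g \<in> carrier G. (lamp G X y g, \<one>\<^bsub>H\<^esub>) \<in> B (max m k))"
      using y R(2) by blast
  qed
  then show "\<exists>n. B n = carrier W" by blast
qed

end

theorem proposition2:
  fixes G :: "('g, 'p) monoid_scheme" and H :: "('h, 'q) monoid_scheme"
    and X :: "'x set" and \<alpha> :: "'h \<Rightarrow> 'x \<Rightarrow> 'x"
  assumes "group G" and "group H" and "carrier G \<noteq> {\<one>\<^bsub>G\<^esub>}"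
    and "group_action H X \<alpha>" and "X \<noteq> {}"
  shows "uncountable_cofinality (wreath_product G X H \<alpha>) \<longleftrightarrow>
    uncountable_cofinality G \<and> uncountable_cofinality H \<and> finite (orbits H X \<alpha>)"
proof -
  interpret permutational_wreath G H X \<alpha>
    using assms by (simp add: permutational_wreath_def)
  show ?thesis
    using uncountable_cofinality_lamp_group uncountable_cofinality_acting_group finite_orbits
      uncountable_cofinality_wreath assms(3,5) by blast
qed

end
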